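(* Let $(\phi^n,\phi^{n+1},\xi^{n+1})$ satisfy one step of the one-dimensional fully-discrete upwind-SAV scheme described in the context. If $|\phi_i^{n}|<1$ for all $i=1,\dots,N_x$, then $|\phi_i^{n+1}|<1$ for all $i=1,\dots,N_x$.
   Context: Parameters: an integer $N_x\ge 2$ (number of cells), cell size $\Delta x>0$, time step $\Delta t>0$, interface parameter $\varepsilon>0$, a positive integer $k$. The potential $F:I\to\mathbb{R}$ is the free energy density, differentiable on its domain of definition $I\subseteq\mathbb{R}$, an interval; typical choices are the logarithmic Flory--Huggins potential $F(\phi)=\frac{\theta}{2}[(1+\phi)\ln(1+\phi)+(1-\phi)\ln(1-\phi)]+\frac{\theta_c}{2}(1-\phi^2)$ with $0<\theta<\theta_c$ (differentiable on $I=(-1,1)$), or the polynomial potential $F(\phi)=\frac14(1-\phi^2)^2$ (with $I=\mathbb{R}$). Notation: $\chi^+=\max\{\chi,0\}$, $\chi^-=\min\{\chi,0\}$, and the mobility is $M(\chi_1,\chi_2)=\big[(1+\chi_1)^+(1-\chi_2)^+\big]^k$. Scheme: one step from the cell averages $\phi^n=(\phi_i^n)_{i=1}^{N_x}$ to $\phi^{n+1}=(\phi_i^{n+1})_{i=1}^{N_x}$ and $\xi^{n+1}\in\mathbb{R}$ (all cell averages in $I$) means that the following hold: $$\phi_i^{n+1}-\phi_i^n=-\frac{\Delta t}{\Delta x}\left(J_{i+\frac12}^{n+1}-J_{i-\frac12}^{n+1}\right),\quad 1\le i\le N_x,$$ $$J_{i+\frac12}^{n+1}=\left(V_{i+\frac12}^{n+1}\right)^+M(\phi_i^{n+1},\phi_{i+1}^{n+1})+\left(V_{i+\frac12}^{n+1}\right)^-M(\phi_{i+1}^{n+1},\phi_i^{n+1}),\quad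 1\le i\le N_x-1,$$ $$V_{i+\frac12}^{n+1}=-\frac{1}{\Delta x}\left(\mu_{i+1}^{n+1}-\mu_i^{n+1}\right),\quad 1\le i\le N_x-1,$$ $$\mu_i^{n+1}=-\varepsilon^2(\Delta\phi)_i^{n+1}+\xi^{n+1}F'(\phi_i^{n+1}),\quad 1\le i\le N_x,$$ $$\sum_{i=1}^{N_x}\left(F(\phi_i^{n+1})-F(\phi_i^n)\right)=\xi^{n+1}\sum_{i=1}^{N_x}F'(\phi_i^{n+1})(\phi_i^{n+1}-\phi_i^n),$$ where $(\nabla\phi)_{i+\frac12}^{n}=\frac{\phi_{i+1}^{n}-\phi_i^{n}}{\Delta x}$ for $1\le i\le N_x-1$, $(\nabla\phi)_{\frac12}^{n}=(\nabla\phi)_{N_x+\frac12}^{n}=0$, $(\Delta\phi)_i^{n+1}=\frac{(\nabla\phi)_{i+\frac12}^{n+1}-(\nabla\phi)_{i-\frac12}^{n+1}}{\Delta x}$ for $1\le i\le N_x$, and the no-flux boundary conditions are $J_{\frac12}^{n+1}=J_{N_x+\frac12}^{n+1}=0$. *)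

theory Defs
  imports "HOL-Analysis.Analysis"
begin

text \<open>
  A grid function is a map \<open>nat \<Rightarrow> real\<close>; only its values at the cells \<open>i \<in> {1..Nx}\<close> matter.
  A quantity living on cell interfaces is also indexed by \<open>nat\<close>: index \<open>i \<in> {0..Nx}\<close> stands for the
  interface \<open>i + 1/2\<close> between cells \<open>i\<close> and \<open>i + 1\<close>, so \<open>0\<close> and \<open>Nx\<close> are the boundary interfaces.
\<close>

definition pos_part :: "real \<Rightarrow> real" where
  "pos_part x = max x 0"

text \<open>The negative part keeps its sign.\<close>

definition neg_part :: "real \<Rightarrow> real" where
  "neg_part x = min x 0"

definition mobility :: "nat \<Rightarrow> real \<Rightarrow> real \<Rightarrow> real" where
  "mobility k \<chi>1 \<chi>2 = (pos_part (1 + \<chi>1) * pos_part (1 - \<chi>2)) ^ k"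

definition grad :: "nat \<Rightarrow> real \<Rightarrow> (nat \<Rightarrow> real) \<Rightarrow> nat \<Rightarrow> real" where
  "grad Nx dx \<phi> i = (if 1 \<le> i \<and> i < Nx then (\<phi> (i + 1) - \<phi> i) / dx else 0)"

definition lap :: "nat \<Rightarrow> real \<Rightarrow> (nat \<Rightarrow> real) \<Rightarrow> nat \<Rightarrow> real" where
  "lap Nx dx \<phi> i = (grad Nx dx \<phi> i - grad Nx dx \<phi> (i - 1)) / dx"

definition chem_pot ::
  "nat \<Rightarrow> real \<Rightarrow> real \<Rightarrow> (real \<Rightarrow> real) \<Rightarrow> (nat \<Rightarrow> real) \<Rightarrow> real \<Rightarrow> nat \<Rightarrow> real" where
  "chem_pot Nx dx \<epsilon> F' \<phi> \<xi> i = - \<epsilon>\<^sup>2 * lap Nx dx \<phi> i + \<xi> * F' (\<phi> i)"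

definition velocity ::
  "nat \<Rightarrow> real \<Rightarrow> real \<Rightarrow> (real \<Rightarrow> real) \<Rightarrow> (nat \<Rightarrow> real) \<Rightarrow> real \<Rightarrow> nat \<Rightarrow> real" where
  "velocity Nx dx \<epsilon> F' \<phi> \<xi> i =
     - (1 / dx) * (chem_pot Nx dx \<epsilon> F' \<phi> \<xi> (i + 1) - chem_pot Nx dx \<epsilon> F' \<phi> \<xi> i)"

text \<open>The upwind flux; the case \<open>else 0\<close> is the no-flux condition at the boundary interfaces.\<close>

definition flux ::
  "nat \<Rightarrow> real \<Rightarrow> real \<Rightarrow> nat \<Rightarrow> (real \<Rightarrow> real) \<Rightarrow> (nat \<Rightarrow> real) \<Rightarrow> real \<Rightarrow> nat \<Rightarrow> real" where
  "flux Nx dx \<epsilon> k F' \<phi> \<xi> i =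
     (if 1 \<le> i \<and> i < Nx
      then pos_part (velocity Nx dx \<epsilon> F' \<phi> \<xi> i) * mobility k (\<phi> i) (\<phi> (i + 1))
         + neg_part (velocity Nx dx \<epsilon> F' \<phi> \<xi> i) * mobility k (\<phi> (i + 1)) (\<phi> i)
      else 0)"

text \<open>
  One time step from \<open>\<phi>\<close> to \<open>(\<psi>, \<xi>)\<close>. All fluxes are implicit, i.e. evaluated at \<open>(\<psi>, \<xi>)\<close>.
  The parameter \<open>F'\<close> is meant to be the derivative on \<open>I\<close> of the potential \<open>F\<close>.
\<close>

definition upwind_SAV_step ::
  "nat \<Rightarrow> real \<Rightarrow> real \<Rightarrow> real \<Rightarrow> nat \<Rightarrow> real set \<Rightarrow> (real \<Rightarrow> real) \<Rightarrow> (real \<Rightarrow> real)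
   \<Rightarrow> (nat \<Rightarrow> real) \<Rightarrow> (nat \<Rightarrow> real) \<Rightarrow> real \<Rightarrow> bool" where
  "upwind_SAV_step Nx dx dt \<epsilon> k I F F' \<phi> \<psi> \<xi> \<longleftrightarrow>
     (\<forall>i\<in>{1..Nx}. \<phi> i \<in> I \<and> \<psi> i \<in> I) \<and>
     (\<forall>i\<in>{1..Nx}. \<psi> i - \<phi> i =
        - (dt / dx) * (flux Nx dx \<epsilon> k F' \<psi> \<xi> i - flux Nx dx \<epsilon> k F' \<psi> \<xi> (i - 1))) \<and>
     (\<Sum>i=1..Nx. F (\<psi> i) - F (\<phi> i)) = \<xi> * (\<Sum>i=1..Nx. F' (\<psi> i) * (\<psi> i - \<phi> i))"

end

theory Submission
  imports Defs
begin

text \<open>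
  The argument is local to a cell. If \<open>\<psi> i\<close> had left \<open>(-1, 1)\<close>, the mobility of every
  flux carrying mass further out through an interface of cell \<open>i\<close> would vanish, because the upwind
  flux is implicit. The remaining fluxes push \<open>\<psi> i\<close> back from \<open>\<phi> i\<close> towards the interval,
  which contradicts \<open>\<bar>\<phi> i\<bar> < 1\<close>.
\<close>

lemma mobility_nonneg: "0 \<le> mobility k a b"
  by (simp add: mobility_def pos_part_def)

lemma mobility_eq_0: "k > 0 \<Longrightarrow> a \<le> -1 \<or> b \<ge> 1 \<Longrightarrow> mobility k a b = 0"
  by (auto simp: mobility_def pos_part_def max_def)

text \<open>The mobility paired with \<open>pos_part\<close> of the velocity vanishes, so only the
  \<open>neg_part\<close> term can survive.\<close>

lemma flux_nonpos:
  assumes "k > 0" "\<psi> i \<le> -1 \<or> \<psi> (i + 1) \<ge> 1"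
  shows "flux Nx dx \<epsilon> k F' \<psi> \<xi> i \<le> 0"
  using mobility_eq_0[OF assms]
  by (auto simp: flux_def neg_part_def intro!: mult_nonpos_nonneg mobility_nonneg)

text \<open>Mirror case: the mobility paired with \<open>neg_part\<close> vanishes.\<close>

lemma flux_nonneg:
  assumes "k > 0" "\<psi> (i + 1) \<le> -1 \<or> \<psi> i \<ge> 1"
  shows "0 \<le> flux Nx dx \<epsilon> k F' \<psi> \<xi> i"
  using mobility_eq_0[OF assms]
  by (auto simp: flux_def pos_part_def intro!: mult_nonneg_nonneg mobility_nonneg)

theorem theorem1:
  fixes Nx k :: nat
    and dx dt \<epsilon> \<xi> :: real
    and I :: "real set"
    and F F' :: "real \<Rightarrow> real"
    and \<phi> \<psi> :: "nat \<Rightarrow> real"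
  assumes "Nx \<ge> 2" and "dx > 0" and "dt > 0" and "\<epsilon> > 0" and "k > 0"
    and "is_interval I"
    and "\<And>x. x \<in> I \<Longrightarrow> (F has_real_derivative F' x) (at x within I)"
    and "upwind_SAV_step Nx dx dt \<epsilon> k I F F' \<phi> \<psi> \<xi>"
    and "\<forall>i\<in>{1..Nx}. \<bar>\<phi> i\<bar> < 1"
  shows "\<forall>i\<in>{1..Nx}. \<bar>\<psi> i\<bar> < 1"
proof
  fix i assume i: "i \<in> {1..Nx}"
  let ?J = "flux Nx dx \<epsilon> k F' \<psi> \<xi>"
  have step: "\<psi> i - \<phi> i = - (dt / dx) * (?J i - ?J (i - 1))"
    using assms(8) i unfolding upwind_SAV_step_def by blast
  have ratio: "dt / dx \<ge> 0"
    using assms(2,3) by simp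
  \<comment> \<open>Since \<open>i \<ge> 1\<close>, subtraction does not truncate, and the flux
    lemmas at \<open>i - 1\<close> speak about \<open>\<psi> i\<close>.\<close>
  have suc: "i - 1 + 1 = i"
    using i by simp
  have phi: "\<bar>\<phi> i\<bar> < 1"
    using assms(9) i by blast
  have "\<psi> i > -1"
  proof (rule ccontr)
    assume "\<not> \<psi> i > -1"
    then have "?J i \<le> 0" "0 \<le> ?J (i - 1)"
      using \<open>k > 0\<close> suc by (auto intro: flux_nonpos flux_nonneg)
    \<comment> \<open>By \<open>step\<close> this product is \<open>\<psi> i - \<phi> i\<close>,
      whence \<open>\<phi> i \<le> \<psi> i \<le> -1\<close>.\<close>
    then have "0 \<le> (dt / dx) * (?J (i - 1) - ?J i)"
      using ratio by (intro mult_nonneg_nonneg) auto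
    then show False
      using step phi \<open>\<not> \<psi> i > -1\<close> by (simp add: algebra_simps)
  qed
  moreover have "\<psi> i < 1"
  proof (rule ccontr)
    assume "\<not> \<psi> i < 1"
    then have "0 \<le> ?J i" "?J (i - 1) \<le> 0"
      using \<open>k > 0\<close> suc by (auto intro: flux_nonpos flux_nonneg)
    then have "0 \<le> (dt / dx) * (?J i - ?J (i - 1))"
      using ratio by (intro mult_nonneg_nonneg) auto
    then show False
      using step phi \<open>\<not> \<psi> i < 1\<close> by (simp add: algebra_simps)
  qed
  ultimately show "\<bar>\<psi> i\<bar> < 1"
    by simp
qed

end
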